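(* Let $\tilde Y,Y\in\mathbb{R}^{n\times p}$ and $\tilde Z,Z\in\mathbb{R}^{m\times p}$ with $m,n>p$ be of full column rank, and suppose that $\begin{bmatrix}\tilde Y\\\tilde Z\end{bmatrix}$ and $\begin{bmatrix}Y\\Z\end{bmatrix}$ are column orthonormal. Then $$\mathrm{dist}(\mathrm{span}\{\tilde Y\},\mathrm{span}\{Y\})\le\sqrt{1+\sigma_{\max}^2(\{\tilde Y,\tilde Z\})}\;\mathrm{dist}\left(\mathrm{span}\left\{\begin{bmatrix}\tilde Y\\\tilde Z\end{bmatrix}\right\},\mathrm{span}\left\{\begin{bmatrix}Y\\Z\end{bmatrix}\right\}\right),$$ $$\mathrm{dist}(\mathrm{span}\{\tilde Z\},\mathrm{span}\{Z\})\le\sqrt{1+\sigma_{\max}^2(\{\tilde Z,\tilde Y\})}\;\mathrm{dist}\left(\mathrm{span}\left\{\begin{bmatrix}\tilde Y\\\tilde Z\end{bmatrix}\right\},\mathrm{span}\left\{\begin{bmatrix}Y\\Z\end{bmatrix}\right\}\right),$$ where $\sigma_{\max}(\{\cdot,\cdot\})$ denotes the largest generalized singular value of the matrix pair (convention in the context).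
   Context: $\|\cdot\|$ is the 2-norm; $\mathrm{span}\{M\}$ is the column space of $M$; for subspaces of equal dimension, $\mathrm{dist}(\mathcal{S}_1,\mathcal{S}_2)=\|P_1-P_2\|$ with $P_i$ the orthogonal projector onto $\mathcal{S}_i$. Convention for generalized singular values: write the generalized singular value decomposition $\tilde Z=WCX^{-1}$, $\tilde Y=GSX^{-1}$ with $W\in\mathbb{R}^{m\times p}$, $G\in\mathbb{R}^{n\times p}$ column orthonormal, $X\in\mathbb{R}^{p\times p}$ nonsingular, $C=\mathrm{diag}(\alpha_1,\ldots,\alpha_p)$, $S=\mathrm{diag}(\beta_1,\ldots,\beta_p)$, $C^2+S^2=I_p$, $1>\alpha_1\ge\cdots\ge\alpha_p>0$, $0<\beta_1\le\cdots\le\beta_p<1$. The generalized singular values of the pair $\{\tilde Y,\tilde Z\}$ are the ratios $\alpha_i/\beta_i$, so $\sigma_{\max}(\{\tilde Y,\tilde Z\})=\alpha_1/\beta_1=\max_{x\ne0}\|\tilde Zx\|/\|\tilde Yx\|$; those of $\{\tilde Z,\tilde Y\}$ are $\beta_i/\alpha_i$, so $\sigma_{\max}(\{\tilde Z,\tilde Y\})=\beta_p/\alpha_p=\max_{x\ne0}\|\tilde Yx\|/\|\tilde Zx\|$. *)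

theory Defs
  imports "HOL-Analysis.Analysis"
begin

definition mnorm :: "real^'a^'b \<Rightarrow> real"
  where "mnorm A = onorm (\<lambda>x. A *v x)"

definition orth_projector :: "(real^'a) set \<Rightarrow> real^'a^'a"
  where "orth_projector S =
    (THE P. P ** P = P \<and> transpose P = P \<and> range (\<lambda>x. P *v x) = S)"

definition subspace_dist :: "(real^'a) set \<Rightarrow> (real^'a) set \<Rightarrow> real"
  where "subspace_dist S T = mnorm (orth_projector S - orth_projector T)"

definition column_space :: "real^'p^'a \<Rightarrow> (real^'a) set"
  where "column_space A = span (columns A)"

definition column_orthonormal :: "real^'p^'a \<Rightarrow> bool"
  where "column_orthonormal A \<longleftrightarrow> transpose A ** A = mat 1"

text \<open>The rows of the block matrix with upper block \<open>Y\<close> and lower block \<open>Z\<close> are indexed by the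
  disjoint sum of the two row index types.\<close>

definition vstack :: "real^'p^'n \<Rightarrow> real^'p^'m \<Rightarrow> real^'p^('n + 'm)"
  where "vstack Y Z = (\<chi> k. case k of Inl i \<Rightarrow> Y $ i | Inr j \<Rightarrow> Z $ j)"

definition diag_mat :: "real^'p \<Rightarrow> real^'p^'p"
  where "diag_mat a = (\<chi> i j. if i = j then a $ i else 0)"

text \<open>\<open>is_gsvd Y Z W G X a b\<close>: the matrices form the decomposition
  \<open>Z = W C X\<^sup>-\<^sup>1\<close>, \<open>Y = G S X\<^sup>-\<^sup>1\<close> with \<open>C = diag a\<close> and \<open>S = diag b\<close>. The column index type is
  linearly ordered so that \<open>a\<close> can be required to be decreasing and \<open>b\<close> increasing.\<close>

definition is_gsvd ::
  "real^('p::{finite,linorder})^'n \<Rightarrow> real^('p::{finite,linorder})^'m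
    \<Rightarrow> real^('p::{finite,linorder})^'m \<Rightarrow> real^('p::{finite,linorder})^'n
    \<Rightarrow> real^('p::{finite,linorder})^('p::{finite,linorder})
    \<Rightarrow> real^('p::{finite,linorder}) \<Rightarrow> real^('p::{finite,linorder}) \<Rightarrow> bool"
  where "is_gsvd Y Z W G X a b \<longleftrightarrow>
    Z = W ** diag_mat a ** matrix_inv X \<and>
    Y = G ** diag_mat b ** matrix_inv X \<and>
    column_orthonormal W \<and> column_orthonormal G \<and> invertible X \<and>
    diag_mat a ** diag_mat a + diag_mat b ** diag_mat b = mat 1 \<and>
    (\<forall>i. 0 < a $ i \<and> a $ i < 1) \<and> (\<forall>i. 0 < b $ i \<and> b $ i < 1) \<and>
    (\<forall>i j. i \<le> j \<longrightarrow> a $ j \<le> a $ i \<and> b $ i \<le> b $ j)"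

text \<open>The values do not depend on the decomposition chosen. The pair is ordered: the entries
  belonging to the second matrix are divided by those belonging to the first. Exchanging the two
  matrices exchanges \<open>a\<close> and \<open>b\<close> (with the order of the columns reversed), so it inverts the ratios.\<close>

definition gen_singular_values ::
  "real^('p::{finite,linorder})^'n \<Rightarrow> real^('p::{finite,linorder})^'m \<Rightarrow> real set"
  where "gen_singular_values Y Z =
    {a $ i / b $ i | W G X a b i. is_gsvd Y Z W G X a b}"

definition sigma_max :: "real^('p::{finite,linorder})^'n \<Rightarrow> real^('p::{finite,linorder})^'m \<Rightarrow> real"
  where "sigma_max Y Z = Max (gen_singular_values Y Z)"

end

theory Submission
  imports Defs
begin

text \<open>
  The distance of two subspaces of equal dimension is controlled by a one-sided gap: if every
  \<open>u\<close> in \<open>S\<close> lies within \<open>\<gamma> \<parallel>u\<parallel>\<close> of \<open>T\<close>, then the distance is at most \<open>\<gamma>\<close>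
  (\<open>subspace_dist_le_one_sided_gap\<close>). Equality of the dimensions enters because it makes the gap
  from \<open>S\<close> to \<open>T\<close> bound the gap from \<open>T\<close> to \<open>S\<close> (\<open>one_sided_gap_symmetric\<close>).

  Write \<open>Qt\<close> and \<open>Q\<close> for the stacked matrices and \<open>d\<close> for the distance of their column spaces.
  For a vector \<open>x\<close>, project \<open>Qt x\<close> onto the column space of \<open>Q\<close>; the projection is some \<open>Q y\<close>, and
  \<open>\<parallel>Qt x - Q y\<parallel> \<le> d \<parallel>x\<parallel>\<close> because \<open>Qt\<close> preserves norms. Keeping only the upper block can only
  shrink this difference, so \<open>Yt x\<close> lies within \<open>d \<parallel>x\<parallel>\<close> of the column space of \<open>Y\<close>. What is left
  is to bound \<open>\<parallel>x\<parallel>\<close> by a multiple of \<open>\<parallel>Yt x\<parallel>\<close>; this is where the factor in the claim comes from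
  (\<open>subspace_dist_column_space_le\<close>).

  In a generalized singular value decomposition of a pair whose stacked matrix is column
  orthonormal, \<open>X\<close> is orthogonal, and the numbers \<open>b i\<close> are the ordinary singular values of \<open>Yt\<close>.
  Hence \<open>\<parallel>x\<parallel> \<le> \<parallel>Yt x\<parallel> / b k\<close> for the smallest entry \<open>b k\<close>, and
  \<open>1 / (b k)\<^sup>2 = 1 + (a k / b k)\<^sup>2\<close> since \<open>(a k)\<^sup>2 + (b k)\<^sup>2 = 1\<close> (\<open>norm_le_sigma_max\<close>).
  As the largest generalized singular value is a maximum over all decompositions, this needs two
  further facts: a decomposition exists (\<open>is_gsvd_exists\<close>, from the spectral theorem applied to the
  Gram matrix of \<open>Yt\<close>), and all decompositions give the same finite set of ratios
  (\<open>gen_singular_values_eq\<close>). The inequality for the lower blocks is the same argument with the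
  roles of the blocks exchanged.
\<close>

section \<open>Eigenvectors of symmetric matrices\<close>

lemma inner_transpose_matrix:
  fixes A :: "real^'a^'b"
  shows "(transpose A *v x) \<bullet> y = x \<bullet> (A *v y)"
  by (simp add: dot_lmul_matrix vector_transpose_matrix)

text \<open>With \<open>l = v \<bullet> f v\<close>, the form \<open>q x = l (x \<bullet> x) - x \<bullet> f x\<close> is nonnegative on \<open>S\<close> and
  vanishes at \<open>v\<close>. Its derivative at \<open>v\<close> in the direction of the residual \<open>w = f v - l v\<close> is
  \<open>- 2 (w \<bullet> w)\<close>, so a nonzero residual would make \<open>q\<close> negative near \<open>v\<close>.\<close>

lemma rayleigh_maximizer_eigenvector:
  fixes f :: "'a::euclidean_space \<Rightarrow> 'a"
  assumes "linear f" and sym: "\<And>x y. f x \<bullet> y = x \<bullet> f y"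
    and "subspace S" and v: "v \<in> S" "norm v = 1" and fv: "f v \<in> S"
    and max: "\<And>x. x \<in> S \<Longrightarrow> norm x = 1 \<Longrightarrow> x \<bullet> f x \<le> v \<bullet> f v"
  shows "f v = (v \<bullet> f v) *\<^sub>R v"
proof -
  interpret linear f by fact
  define l where "l = v \<bullet> f v"
  define q where "q x = l * (x \<bullet> x) - x \<bullet> f x" for x
  define w where "w = f v - l *\<^sub>R v"
  have q_nonneg: "0 \<le> q x" if "x \<in> S" for x
  proof (cases "x = 0")
    case False
    have "(x /\<^sub>R norm x) \<bullet> f (x /\<^sub>R norm x) \<le> l"
      unfolding l_def using False that \<open>subspace S\<close> by (intro max) (auto simp: subspace_scale)
    then have "x \<bullet> f x \<le> l * (norm x * norm x)"
      using False by (simp add: scale field_simps)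
    then show ?thesis
      by (simp add: q_def dot_square_norm power2_eq_square)
  qed (simp add: q_def zero)
  have wS: "w \<in> S"
    unfolding w_def using v fv \<open>subspace S\<close> by (auto intro: subspace_diff subspace_scale)
  have vv: "v \<bullet> v = 1"
    using v by (simp add: dot_square_norm)
  have expand: "q (v + t *\<^sub>R w) = t\<^sup>2 * q w - 2 * t * (w \<bullet> w)" for t
  proof -
    have "q (v + t *\<^sub>R w) = q v + 2 * t * (l * (v \<bullet> w) - f v \<bullet> w) + t\<^sup>2 * q w"
      using sym[of v w]
      by (simp add: q_def add scale inner_add_left inner_add_right algebra_simps
          power2_eq_square inner_commute)
    moreover have "q v = 0"
      by (simp add: q_def vv l_def)
    moreover have "l * (v \<bullet> w) - f v \<bullet> w = - (w \<bullet> w)"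
      by (simp add: w_def inner_diff_left inner_diff_right algebra_simps)
    ultimately show ?thesis by simp
  qed
  define Q W where "Q = q w" and "W = w \<bullet> w"
  have "0 \<le> Q" "0 \<le> W"
    using q_nonneg[OF wS] by (simp_all add: Q_def W_def)
  \<comment> \<open>A step that makes \<open>t\<^sup>2 Q - 2 t W\<close> negative unless \<open>W = 0\<close>; the added 1 covers \<open>Q = 0\<close>.\<close>
  define t where "t = W / (Q + 1)"
  have "0 \<le> t\<^sup>2 * Q - 2 * t * W"
    using expand[of t] q_nonneg[of "v + t *\<^sub>R w"] v wS \<open>subspace S\<close>
    by (simp add: Q_def W_def subspace_add subspace_scale)
  moreover have "t * (Q + 1) = W"
    using \<open>0 \<le> Q\<close> by (simp add: t_def)
  then have "t\<^sup>2 * Q - 2 * t * W = - (t\<^sup>2 * (Q + 2))"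
    by (auto simp: power2_eq_square algebra_simps)
  ultimately have "t\<^sup>2 * (Q + 2) \<le> 0" by simp
  then have "t = 0"
    using \<open>0 \<le> Q\<close> by (simp add: mult_le_0_iff)
  then have "W = 0"
    using \<open>t * (Q + 1) = W\<close> by simp
  then show ?thesis
    by (simp add: W_def w_def l_def)
qed

text \<open>The spectral theorem, by induction on the dimension: a maximizer of the Rayleigh quotient on the
  compact unit sphere of \<open>S\<close> is an eigenvector, and its orthogonal complement in \<open>S\<close> is again
  invariant. The eigenvalue of a unit eigenvector \<open>b\<close> is written as \<open>b \<bullet> f b\<close>.\<close>

lemma self_adjoint_orthonormal_eigenbasis:
  fixes f :: "'a::euclidean_space \<Rightarrow> 'a"
  assumes lin: "linear f" and sym: "\<And>x y. f x \<bullet> y = x \<bullet> f y"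
    and "subspace S" and "f ` S \<subseteq> S"
  obtains B where "B \<subseteq> S" "pairwise orthogonal B" "\<And>b. b \<in> B \<Longrightarrow> norm b = 1" "span B = S"
    "\<And>b. b \<in> B \<Longrightarrow> f b = (b \<bullet> f b) *\<^sub>R b"
proof -
  have "\<exists>B \<subseteq> S. pairwise orthogonal B \<and> (\<forall>b\<in>B. norm b = 1) \<and> span B = S
      \<and> (\<forall>b\<in>B. f b = (b \<bullet> f b) *\<^sub>R b)"
    using assms(3,4)
  proof (induction "dim S" arbitrary: S rule: less_induct)
    case less
    note S = \<open>subspace S\<close> \<open>f ` S \<subseteq> S\<close>
    show ?case
    proof (cases "S = {0}")
      case True
      then show ?thesis by (intro exI[of _ "{}"]) auto
    next
      case False
      let ?K = "sphere 0 1 \<inter> S"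
      obtain u where "u \<in> S" "u \<noteq> 0"
        using False S subspace_0 by blast
      then have "u /\<^sub>R norm u \<in> ?K"
        using S by (auto simp: subspace_scale)
      moreover have "compact ?K"
        using S by (intro compact_Int_closed closed_subspace) auto
      moreover have "continuous_on ?K (\<lambda>x. x \<bullet> f x)"
        using lin linear_continuous_on
        by (intro continuous_on_inner continuous_on_id) (simp add: linear_conv_bounded_linear)
      ultimately obtain v where v: "v \<in> ?K" "\<And>x. x \<in> ?K \<Longrightarrow> x \<bullet> f x \<le> v \<bullet> f v"
        using continuous_attains_sup[of ?K "\<lambda>x. x \<bullet> f x"] by blast
      have eig: "f v = (v \<bullet> f v) *\<^sub>R v"
        using v S by (intro rayleigh_maximizer_eigenvector[OF lin sym, of S]) auto
      have vv: "v \<bullet> v = 1" "norm v = 1"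
        using v by (auto simp: dot_square_norm)
      define T where "T = {x \<in> S. v \<bullet> x = 0}"
      have T: "subspace T"
        using S by (auto simp: T_def subspace_def inner_add_right)
      have fT: "f ` T \<subseteq> T"
      proof
        fix y assume "y \<in> f ` T"
        then obtain x where x: "x \<in> S" "v \<bullet> x = 0" "y = f x" by (auto simp: T_def)
        have "v \<bullet> f x = f v \<bullet> x" by (simp add: sym)
        also have "\<dots> = (v \<bullet> f v) * (v \<bullet> x)" by (subst eig) simp
        finally show "y \<in> T" using x S by (auto simp: T_def)
      qed
      have "v \<in> S" "v \<notin> T"
        using v vv by (auto simp: T_def)
      moreover have "T \<subseteq> S"
        by (auto simp: T_def)
      ultimately have "T \<subset> S"
        by blast
      then have "dim T < dim S"
        using T S by (intro dim_psubset) (simp add: span_eq_iff[THEN iffD2])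
      from less.hyps[OF this T fT] obtain B where B: "B \<subseteq> T" "pairwise orthogonal B"
        "\<forall>b\<in>B. norm b = 1" "span B = T" "\<forall>b\<in>B. f b = (b \<bullet> f b) *\<^sub>R b" by blast
      have "span (insert v B) = S"
      proof
        show "span (insert v B) \<subseteq> S"
          using v B S by (intro span_minimal) (auto simp: T_def)
        show "S \<subseteq> span (insert v B)"
        proof
          fix x assume "x \<in> S"
          then have "x - (v \<bullet> x) *\<^sub>R v \<in> T"
            using v S by (auto simp: T_def vv inner_diff_right subspace_diff subspace_scale)
          then show "x \<in> span (insert v B)"
            using B by (auto simp: span_insert)
        qed
      qed
      moreover have "pairwise orthogonal (insert v B)"
        using B by (auto simp: pairwise_insert T_def orthogonal_def inner_commute)
      ultimately show ?thesis
        using B v vv eig by (intro exI[of _ "insert v B"]) (auto simp: T_def)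
    qed
  qed
  then show ?thesis using that by blast
qed

text \<open>A generalized singular value decomposition demands ordered entries, so the eigenvectors must be
  listed along the order of the index type.\<close>

lemma symmetric_matrix_sorted_eigenvectors:
  fixes A :: "real^('p::{finite,linorder})^('p::{finite,linorder})"
  assumes "transpose A = A"
  obtains v :: "('p::{finite,linorder}) \<Rightarrow> real^('p::{finite,linorder})" and l
  where "\<And>i j. v i \<bullet> v j = (if i = j then 1 else 0)" "\<And>i. A *v v i = l i *\<^sub>R v i" "mono l"
proof -
  have "(A *v x) \<bullet> y = x \<bullet> (A *v y)" for x y
    using inner_transpose_matrix[of A x y] assms by simp
  then obtain B where B: "pairwise orthogonal B" "\<And>b. b \<in> B \<Longrightarrow> norm b = 1"
    "span B = UNIV" "\<And>b. b \<in> B \<Longrightarrow> A *v b = (b \<bullet> (A *v b)) *\<^sub>R b"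
    using self_adjoint_orthonormal_eigenbasis[of "\<lambda>x. A *v x" UNIV]
    by (metis matrix_vector_mul_linear subspace_UNIV top_greatest)
  have "0 \<notin> B"
    using B(2) by force
  then have ind: "independent B"
    using B(1) by (rule pairwise_orthogonal_independent[rotated])
  then have "finite B"
    by (rule independent_imp_finite)
  have card: "card B = CARD('p)"
    using B(3) ind by (metis dim_UNIV dim_eq_card DIM_cart DIM_real mult.right_neutral dim_span)
  define \<rho> where "\<rho> b = b \<bullet> (A *v b)" for b
  obtain ys where ys: "set ys = B" "distinct ys"
    using finite_distinct_list[OF \<open>finite B\<close>] by blast
  define xs where "xs = sort_key \<rho> ys"
  have xs: "set xs = B" "distinct xs" "sorted (map \<rho> xs)" "length xs = CARD('p)"
    using ys card distinct_card[of ys] by (simp_all add: xs_def)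
  \<comment> \<open>The rank of an index in its type; it is strictly increasing, so it picks distinct entries of
    the sorted list \<open>xs\<close>.\<close>
  define pos :: "'p \<Rightarrow> nat" where "pos i = card {j. j < i}" for i
  have pos_less: "pos i < length xs" for i
    unfolding pos_def xs(4) by (rule psubset_card_mono) auto
  have pos_strict: "pos i < pos j" if "i < j" for i j
    unfolding pos_def using that by (intro psubset_card_mono) auto
  define v where "v i = xs ! pos i" for i
  have vB: "v i \<in> B" for i
    using pos_less[of i] xs(1) by (auto simp: v_def)
  have "v i \<noteq> v j" if "i \<noteq> j" for i j
    using that pos_strict[of i j] pos_strict[of j i] pos_less xs(2)
    by (auto simp: v_def nth_eq_iff_index_eq neq_iff)
  then have "v i \<bullet> v j = (if i = j then 1 else 0)" for i j
    using B(1,2) vB by (auto simp: pairwise_def orthogonal_def dot_square_norm)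
  moreover have "A *v v i = \<rho> (v i) *\<^sub>R v i" for i
    using B(4)[OF vB] by (simp add: \<rho>_def)
  moreover have "mono (\<lambda>i. \<rho> (v i))"
  proof (rule monoI)
    fix i j :: 'p assume "i \<le> j"
    then have "pos i \<le> pos j"
      using pos_strict[of i j] by (auto simp: order.order_iff_strict)
    then show "\<rho> (v i) \<le> \<rho> (v j)"
      using sorted_nth_mono[OF xs(3), of "pos i" "pos j"] pos_less by (simp add: v_def)
  qed
  ultimately show ?thesis by (rule that)
qed

section \<open>Orthogonal projectors and the distance of subspaces\<close>

definition is_orth_projector :: "real^'a^'a \<Rightarrow> (real^'a) set \<Rightarrow> bool"
  where "is_orth_projector P S \<longleftrightarrow> P ** P = P \<and> transpose P = P \<and> range (\<lambda>x. P *v x) = S"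

lemma is_orth_projector_fixes:
  assumes "is_orth_projector P S" "x \<in> S"
  shows "P *v x = x"
  using assms by (auto simp: is_orth_projector_def matrix_vector_mul_assoc)

lemma is_orth_projector_in: "is_orth_projector P S \<Longrightarrow> P *v x \<in> S"
  by (auto simp: is_orth_projector_def)

text \<open>Each of two projectors onto \<open>S\<close> fixes the range of the other, so \<open>Q P = P\<close> and \<open>P Q = Q\<close>; the
  two equations are exchanged by transposition.\<close>

lemma is_orth_projector_unique:
  assumes P: "is_orth_projector P S" and Q: "is_orth_projector Q S"
  shows "P = Q"
proof -
  have "Q ** P = P"
    using is_orth_projector_fixes[OF Q is_orth_projector_in[OF P]]
    by (simp add: matrix_eq flip: matrix_vector_mul_assoc)
  moreover have "P ** Q = Q"
    using is_orth_projector_fixes[OF P is_orth_projector_in[OF Q]]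
    by (simp add: matrix_eq flip: matrix_vector_mul_assoc)
  moreover have "transpose P = P" "transpose Q = Q"
    using P Q by (simp_all add: is_orth_projector_def)
  ultimately show ?thesis
    by (metis matrix_transpose_mul)
qed

lemma is_orth_projector_exists:
  fixes S :: "(real^'a) set"
  assumes "subspace S"
  shows "\<exists>P. is_orth_projector P S"
proof -
  obtain B where B: "B \<subseteq> S" "pairwise orthogonal B" "\<And>x. x \<in> B \<Longrightarrow> norm x = 1"
    "independent B" "span B = S"
    using orthonormal_basis_subspace[OF assms] by metis
  have fin: "finite B" using B(4) by (rule independent_imp_finite)
  define p where "p x = (\<Sum>b\<in>B. (b \<bullet> x) *\<^sub>R b)" for x
  have lin: "linear p"
    by (rule linearI) (simp_all add: p_def inner_add_right scaleR_add_left sum.distrib scaleR_sum_right)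
  have in_S: "p x \<in> S" for x
    unfolding p_def using B assms by (auto intro!: subspace_sum subspace_scale)
  have pb: "p b = b" if "b \<in> B" for b
  proof -
    have "p b = (\<Sum>c\<in>B. if c = b then b else 0)"
      unfolding p_def using B(2,3) that
      by (intro sum.cong) (auto simp: pairwise_def orthogonal_def dot_square_norm)
    then show ?thesis using fin that by simp
  qed
  have fixed: "p x = x" if "x \<in> S" for x
    using linear_eq_on_span[OF lin linear_ident, of B x] pb B(5) that by auto
  have mp: "matrix p *v x = p x" for x
    using lin by (simp add: matrix_vector_mul)
  have "matrix p ** matrix p = matrix p"
    by (simp add: matrix_eq mp fixed[OF in_S] flip: matrix_vector_mul_assoc)
  moreover have "transpose (matrix p) = matrix p"
  proof -
    have "p x \<bullet> y = x \<bullet> p y" for x y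
      unfolding p_def inner_sum_left inner_sum_right
      by (intro sum.cong) (simp_all add: inner_commute)
    then have "(transpose (matrix p) *v x) \<bullet> y = (matrix p *v x) \<bullet> y" for x y
      by (simp only: inner_transpose_matrix mp)
    then have "transpose (matrix p) *v x = matrix p *v x" for x
      by (metis vector_eq_rdot)
    then show ?thesis
      by (simp add: matrix_eq)
  qed
  moreover have "range (\<lambda>x. matrix p *v x) = S"
  proof
    show "range (\<lambda>x. matrix p *v x) \<subseteq> S"
      using in_S by (auto simp: mp)
    show "S \<subseteq> range (\<lambda>x. matrix p *v x)"
      using fixed mp by (metis rangeI subsetI)
  qed
  ultimately show ?thesis
    unfolding is_orth_projector_def by blast
qed

lemma orth_projector_is_orth_projector:
  assumes "subspace S"
  shows "is_orth_projector (orth_projector S) S"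
proof -
  have "\<exists>!P. is_orth_projector P S"
    using is_orth_projector_exists[OF assms] is_orth_projector_unique by blast
  then show ?thesis
    unfolding orth_projector_def is_orth_projector_def by (rule theI')
qed

context
  fixes S :: "(real^'a) set"
  assumes S: "subspace S"
begin

lemma orth_projector_in: "orth_projector S *v x \<in> S"
  using orth_projector_is_orth_projector[OF S] by (auto simp: is_orth_projector_def)

lemma orth_projector_fixes: "x \<in> S \<Longrightarrow> orth_projector S *v x = x"
  using orth_projector_is_orth_projector[OF S] by (rule is_orth_projector_fixes)

lemma orth_projector_self_adjoint: "(orth_projector S *v x) \<bullet> y = x \<bullet> (orth_projector S *v y)"
  using orth_projector_is_orth_projector[OF S] inner_transpose_matrix[of "orth_projector S" x y]
  by (simp add: is_orth_projector_def)

lemma orth_projector_residual_orthogonal: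
  assumes "y \<in> S"
  shows "(x - orth_projector S *v x) \<bullet> y = 0"
  using orth_projector_self_adjoint[of x y] orth_projector_fixes[OF assms]
  by (simp add: inner_diff_left)

lemma orth_projector_pythagoras:
  assumes "y \<in> S"
  shows "(norm (x - y))\<^sup>2
    = (norm (x - orth_projector S *v x))\<^sup>2 + (norm (orth_projector S *v x - y))\<^sup>2"
proof -
  have "orthogonal (x - orth_projector S *v x) (orth_projector S *v x - y)"
    unfolding orthogonal_def using S assms
    by (intro orth_projector_residual_orthogonal subspace_diff orth_projector_in)
  from norm_add_Pythagorean[OF this] show ?thesis by simp
qed

lemma orth_projector_nearest:
  assumes "y \<in> S"
  shows "norm (x - orth_projector S *v x) \<le> norm (x - y)"
proof (rule power2_le_imp_le)
  show "(norm (x - orth_projector S *v x))\<^sup>2 \<le> (norm (x - y))\<^sup>2"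
    using orth_projector_pythagoras[OF assms, of x] by simp
qed simp

end

text \<open>For \<open>\<gamma> \<ge> 1\<close> there is nothing to show. If \<open>\<gamma> < 1\<close>, the projection onto \<open>T\<close> is injective on
  \<open>S\<close>, hence onto \<open>T\<close> by equality of dimensions. So \<open>v = Q u\<close> for some \<open>u\<close> in \<open>S\<close>, and the angle
  between \<open>u\<close> and \<open>v\<close>, whose sine the assumption bounds by \<open>\<gamma>\<close>, also bounds the distance of
  \<open>v\<close> from \<open>S\<close>.\<close>

lemma one_sided_gap_symmetric:
  fixes S T :: "(real^'a) set"
  assumes S: "subspace S" and T: "subspace T" and dim: "dim S = dim T"
    and "0 \<le> \<gamma>"
    and gap: "\<And>u. u \<in> S \<Longrightarrow> norm (u - orth_projector T *v u) \<le> \<gamma> * norm u"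
    and v: "v \<in> T"
  shows "norm (v - orth_projector S *v v) \<le> \<gamma> * norm v"
proof (cases "\<gamma> < 1")
  case False
  have "norm (v - orth_projector S *v v) \<le> norm (v - 0)"
    using S by (intro orth_projector_nearest subspace_0)
  also have "\<dots> \<le> \<gamma> * norm v"
    using False mult_right_mono[of 1 \<gamma> "norm v"] by simp
  finally show ?thesis .
next
  case True
  let ?P = "\<lambda>x. orth_projector S *v x" and ?Q = "\<lambda>x. orth_projector T *v x"
  have \<gamma>2: "\<gamma>\<^sup>2 < 1"
    using True \<open>0 \<le> \<gamma>\<close> by (simp add: power_less_one_iff)
  have lower: "(1 - \<gamma>\<^sup>2) * (norm u)\<^sup>2 \<le> (norm (?Q u))\<^sup>2" if "u \<in> S" for u
  proof -
    have "(norm u)\<^sup>2 = (norm (u - ?Q u))\<^sup>2 + (norm (?Q u))\<^sup>2"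
      using orth_projector_pythagoras[OF T subspace_0[OF T], of u] by simp
    moreover have "(norm (u - ?Q u))\<^sup>2 \<le> (\<gamma> * norm u)\<^sup>2"
      using gap[OF that] by (rule power_mono) simp
    ultimately show ?thesis by (simp add: power_mult_distrib algebra_simps)
  qed
  have lin: "linear ?Q" by simp
  have "inj_on ?Q S"
  proof (rule inj_onI)
    fix x y assume "x \<in> S" "y \<in> S" "?Q x = ?Q y"
    then have "(1 - \<gamma>\<^sup>2) * (norm (x - y))\<^sup>2 \<le> 0"
      using lower[of "x - y"] S by (simp add: subspace_diff matrix_vector_mult_diff_distrib)
    then show "x = y" using \<gamma>2 by (simp add: mult_le_0_iff)
  qed
  then have "dim (?Q ` S) = dim S"
    using S lin by (intro dim_image_eq) (simp_all add: span_eq_iff[THEN iffD2])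
  then have "?Q ` S = T"
    using S T lin dim orth_projector_in[OF T]
    by (intro subspace_dim_equal) (auto intro: linear_subspace_image)
  then obtain u where u: "u \<in> S" "v = ?Q u" using v by auto
  have "(norm v)\<^sup>2 = u \<bullet> v"
    using orth_projector_residual_orthogonal[OF T v, of u] u
    by (simp add: inner_diff_left dot_square_norm)
  also have "\<dots> = u \<bullet> ?P v"
    using orth_projector_self_adjoint[OF S, of u v] orth_projector_fixes[OF S u(1)] by simp
  also have "\<dots> \<le> norm u * norm (?P v)" by (rule norm_cauchy_schwarz)
  finally have "((norm v)\<^sup>2)\<^sup>2 \<le> (norm u)\<^sup>2 * (norm (?P v))\<^sup>2"
    using power_mono[of "(norm v)\<^sup>2" "norm u * norm (?P v)" 2] by (simp add: power_mult_distrib)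
  then have "(1 - \<gamma>\<^sup>2) * ((norm v)\<^sup>2)\<^sup>2 \<le> ((1 - \<gamma>\<^sup>2) * (norm u)\<^sup>2) * (norm (?P v))\<^sup>2"
    using \<gamma>2 mult_left_mono by fastforce
  also have "\<dots> \<le> (norm v)\<^sup>2 * (norm (?P v))\<^sup>2"
    using lower[OF u(1)] u(2) by (intro mult_right_mono) auto
  finally have "(norm v)\<^sup>2 * ((1 - \<gamma>\<^sup>2) * (norm v)\<^sup>2) \<le> (norm v)\<^sup>2 * (norm (?P v))\<^sup>2"
    by (simp add: power2_eq_square algebra_simps)
  then have "(1 - \<gamma>\<^sup>2) * (norm v)\<^sup>2 \<le> (norm (?P v))\<^sup>2"
    by (cases "v = 0") (simp_all add: mult_le_cancel_left_pos)
  moreover have "(norm v)\<^sup>2 = (norm (v - ?P v))\<^sup>2 + (norm (?P v))\<^sup>2"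
    using orth_projector_pythagoras[OF S subspace_0[OF S], of v] by simp
  ultimately have "(norm (v - ?P v))\<^sup>2 \<le> (\<gamma> * norm v)\<^sup>2"
    by (simp add: power_mult_distrib algebra_simps)
  then show ?thesis
    by (rule power2_le_imp_le) (simp add: \<open>0 \<le> \<gamma>\<close>)
qed

text \<open>Split \<open>x\<close> into \<open>z = Q x\<close> in \<open>T\<close> and \<open>y = x - z\<close> orthogonal to \<open>T\<close>. Then
  \<open>(P - Q) x = P y - (z - P z)\<close> is a sum of orthogonal vectors. The second has norm at most
  \<open>\<gamma> \<parallel>z\<parallel>\<close> by the reversed gap. So has the first, with \<open>y\<close> for \<open>z\<close>, because \<open>P y\<close> pairs with
  \<open>y\<close> only through its part orthogonal to \<open>T\<close>.\<close>

lemma subspace_dist_le_one_sided_gap: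
  fixes S T :: "(real^'a) set"
  assumes S: "subspace S" and T: "subspace T" and dim: "dim S = dim T"
    and "0 \<le> \<gamma>"
    and near: "\<And>u. u \<in> S \<Longrightarrow> \<exists>t\<in>T. norm (u - t) \<le> \<gamma> * norm u"
  shows "subspace_dist S T \<le> \<gamma>"
proof -
  let ?P = "\<lambda>x. orth_projector S *v x" and ?Q = "\<lambda>x. orth_projector T *v x"
  have gapS: "norm (u - ?Q u) \<le> \<gamma> * norm u" if "u \<in> S" for u
    using near[OF that] orth_projector_nearest[OF T] order_trans by blast
  have gapT: "norm (v - ?P v) \<le> \<gamma> * norm v" if "v \<in> T" for v
    using one_sided_gap_symmetric[OF S T dim \<open>0 \<le> \<gamma>\<close> gapS that] .
  have "norm (?P x - ?Q x) \<le> \<gamma> * norm x" for x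
  proof -
    define y z where "y = x - ?Q x" and "z = ?Q x"
    have Py: "norm (?P y) \<le> \<gamma> * norm y"
    proof -
      have Qy: "y \<bullet> ?Q (?P y) = 0"
        using orth_projector_residual_orthogonal[OF T orth_projector_in[OF T, of "?P y"], of x]
        by (simp add: y_def)
      have "(norm (?P y))\<^sup>2 = ?P y \<bullet> y"
        using orth_projector_self_adjoint[OF S] orth_projector_fixes[OF S orth_projector_in[OF S]]
        by (simp add: power2_norm_eq_inner)
      also have "\<dots> = (?P y - ?Q (?P y)) \<bullet> y"
        using Qy by (simp add: inner_diff_right inner_commute)
      also have "\<dots> \<le> norm (?P y - ?Q (?P y)) * norm y" by (rule norm_cauchy_schwarz)
      also have "\<dots> \<le> (\<gamma> * norm (?P y)) * norm y"
        by (intro mult_right_mono gapS orth_projector_in[OF S]) simp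
      finally have "norm (?P y) * norm (?P y) \<le> norm (?P y) * (\<gamma> * norm y)"
        by (simp add: power2_eq_square algebra_simps)
      then show ?thesis
        using \<open>0 \<le> \<gamma>\<close> by (cases "?P y = 0") (simp_all add: mult_le_cancel_left_pos)
    qed
    have zT: "z \<in> T" unfolding z_def by (rule orth_projector_in[OF T])
    have split: "?P x - ?Q x = ?P y + (?P z - z)"
      by (simp add: y_def z_def matrix_vector_mult_diff_distrib)
    have "orthogonal (?P y) (?P z - z)"
      using orth_projector_residual_orthogonal[OF S orth_projector_in[OF S, of y], of z]
      by (simp add: orthogonal_def inner_diff_left inner_diff_right inner_commute)
    then have "(norm (?P x - ?Q x))\<^sup>2 = (norm (?P y))\<^sup>2 + (norm (z - ?P z))\<^sup>2"
      unfolding split norm_minus_commute[of z] by (rule norm_add_Pythagorean)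
    also have "\<dots> \<le> (\<gamma> * norm y)\<^sup>2 + (\<gamma> * norm z)\<^sup>2"
      using Py gapT[OF zT] by (intro add_mono power_mono) auto
    also have "\<dots> = (\<gamma> * norm x)\<^sup>2"
      using orth_projector_pythagoras[OF T subspace_0[OF T], of x]
      by (simp add: y_def z_def power_mult_distrib distrib_left)
    finally show ?thesis
      by (rule power2_le_imp_le) (simp add: \<open>0 \<le> \<gamma>\<close>)
  qed
  then have bound: "norm ((orth_projector S - orth_projector T) *v x) \<le> \<gamma> * norm x" for x
    by (metis matrix_vector_mult_diff_rdistrib)
  show ?thesis
    unfolding subspace_dist_def mnorm_def
  proof (rule onorm_le)
    show "norm ((orth_projector S - orth_projector T) *v x) \<le> \<gamma> * norm x" for x
      by (fact bound)
  qed
qed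

lemma subspace_dist_residual_le:
  fixes S T :: "(real^'a) set"
  assumes S: "subspace S" and T: "subspace T" and u: "u \<in> S"
  shows "norm (u - orth_projector T *v u) \<le> subspace_dist S T * norm u"
proof -
  have "norm ((orth_projector S - orth_projector T) *v u) \<le> subspace_dist S T * norm u"
    unfolding subspace_dist_def mnorm_def
    by (rule onorm) (simp add: matrix_vector_mul_bounded_linear)
  then show ?thesis
    using orth_projector_fixes[OF S u] by (simp add: matrix_vector_mult_diff_rdistrib)
qed

lemma subspace_dist_nonneg: "0 \<le> subspace_dist S T"
  unfolding subspace_dist_def mnorm_def
  by (rule onorm_pos_le) (simp add: matrix_vector_mul_bounded_linear)

section \<open>Column orthonormal and stacked matrices\<close>

lemma column_orthonormal_iff_inner:
  "column_orthonormal A \<longleftrightarrow> (\<forall>i j. column i A \<bullet> column j A = (if i = j then 1 else 0))"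
  by (simp add: column_orthonormal_def vec_eq_iff matrix_matrix_mult_def transpose_def column_def
      mat_def inner_vec_def)

lemma column_orthonormal_inner:
  fixes A :: "real^'p^'a"
  assumes "column_orthonormal A"
  shows "(A *v x) \<bullet> (A *v y) = x \<bullet> y"
proof -
  have "(A *v x) \<bullet> (A *v y) = (transpose A *v (A *v x)) \<bullet> y"
    by (rule inner_transpose_matrix[symmetric])
  also have "transpose A *v (A *v x) = x"
    using assms by (simp add: column_orthonormal_def matrix_vector_mul_assoc)
  finally show ?thesis .
qed

lemma inner_sum_index:
  fixes u w :: "real^('n::finite + 'm::finite)"
  shows "u \<bullet> w = (\<chi> i. u $ Inl i) \<bullet> (\<chi> i. w $ Inl i) + (\<chi> j. u $ Inr j) \<bullet> (\<chi> j. w $ Inr j)"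
  by (simp add: inner_vec_def sum.Plus flip: UNIV_Plus_UNIV)

lemma vstack_vector_nth:
  "(vstack Y Z *v x) $ Inl i = (Y *v x) $ i" "(vstack Y Z *v x) $ Inr j = (Z *v x) $ j"
  by (simp_all add: vstack_def matrix_vector_mult_def)

lemma vstack_inner:
  fixes Y :: "real^'p^'n" and Z :: "real^'p^'m"
  shows "(vstack Y Z *v x) \<bullet> (vstack Y Z *v y) = (Y *v x) \<bullet> (Y *v y) + (Z *v x) \<bullet> (Z *v y)"
  by (simp add: inner_sum_index[of "vstack Y Z *v x"] vstack_vector_nth)

lemma norm_blocks_le:
  fixes Y Y' :: "real^'p^'n" and Z Z' :: "real^'p^'m"
  shows "norm (Y *v x - Y' *v y) \<le> norm (vstack Y Z *v x - vstack Y' Z' *v y)"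
    and "norm (Z *v x - Z' *v y) \<le> norm (vstack Y Z *v x - vstack Y' Z' *v y)"
proof -
  define u where "u = vstack Y Z *v x - vstack Y' Z' *v y"
  have "(\<chi> i. u $ Inl i) = Y *v x - Y' *v y" "(\<chi> j. u $ Inr j) = Z *v x - Z' *v y"
    by (simp_all add: u_def vec_eq_iff vstack_vector_nth)
  then have "u \<bullet> u = (Y *v x - Y' *v y) \<bullet> (Y *v x - Y' *v y) + (Z *v x - Z' *v y) \<bullet> (Z *v x - Z' *v y)"
    using inner_sum_index[of u u] by simp
  then show "norm (Y *v x - Y' *v y) \<le> norm (vstack Y Z *v x - vstack Y' Z' *v y)"
    "norm (Z *v x - Z' *v y) \<le> norm (vstack Y Z *v x - vstack Y' Z' *v y)"
    by (simp_all add: norm_le u_def)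
qed

section \<open>Generalized singular values of an orthonormal pair\<close>

lemma diag_mat_vector: "diag_mat a *v x = (\<chi> i. a $ i * x $ i)"
  by (simp add: diag_mat_def matrix_vector_mult_def vec_eq_iff mult_delta_left)

lemma matrix_diag_mat_nth: "(A ** diag_mat a) $ i $ j = A $ i $ j * a $ j"
  by (simp add: diag_mat_def matrix_matrix_mult_def mult_delta_right)

lemma diag_mat_squares_sum_iff:
  "diag_mat a ** diag_mat a + diag_mat b ** diag_mat b = mat 1 \<longleftrightarrow> (\<forall>i. (a $ i)\<^sup>2 + (b $ i)\<^sup>2 = 1)"
proof -
  have "(diag_mat a ** diag_mat a + diag_mat b ** diag_mat b) $ i $ j
    = (if i = j then (a $ i)\<^sup>2 + (b $ i)\<^sup>2 else 0)" for i j
    by (simp add: matrix_diag_mat_nth) (simp add: diag_mat_def power2_eq_square)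
  then show ?thesis
    by (simp add: vec_eq_iff mat_def)
qed

lemma matrix_inv_left_right:
  assumes "invertible X"
  shows "X ** matrix_inv X = mat 1" "matrix_inv X ** X = mat 1"
  using assms someI_ex[of "\<lambda>B. X ** B = mat 1 \<and> B ** X = mat 1"]
  unfolding invertible_def matrix_inv_def by blast+

text \<open>Let \<open>v i\<close> be orthonormal eigenvectors of the Gram matrix of \<open>Y\<close> with eigenvalues \<open>l i\<close>. Since
  the Gram matrices of \<open>Y\<close> and \<open>Z\<close> add up to the identity, the vectors \<open>Z (v i)\<close> are orthogonal
  as well, with squared norms \<open>1 - l i\<close>. Injectivity gives \<open>0 < l i < 1\<close>, so the images can be
  normalized to the columns of \<open>G\<close> and \<open>W\<close>, and \<open>X\<close> consists of the \<open>v i\<close>.\<close>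

lemma is_gsvd_exists:
  fixes Y :: "real^('p::{finite,linorder})^'n" and Z :: "real^('p::{finite,linorder})^'m"
  assumes inj: "\<And>x. Y *v x = 0 \<Longrightarrow> x = 0" "\<And>x. Z *v x = 0 \<Longrightarrow> x = 0"
    and gram: "\<And>x y. (Y *v x) \<bullet> (Y *v y) + (Z *v x) \<bullet> (Z *v y) = x \<bullet> y"
  shows "\<exists>W G X a b. is_gsvd Y Z W G X a b"
proof -
  define A where "A = transpose Y ** Y"
  have "transpose A = A"
    by (simp add: A_def matrix_transpose_mul)
  then obtain v :: "'p::{finite,linorder} \<Rightarrow> real^('p::{finite,linorder})" and l
    where v: "\<And>i j. v i \<bullet> v j = (if i = j then 1 else 0)"
    and eig: "\<And>i. A *v v i = l i *\<^sub>R v i" and "mono l"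
    by (rule symmetric_matrix_sorted_eigenvectors) blast
  have YY: "(Y *v v i) \<bullet> (Y *v v j) = (if i = j then l i else 0)" for i j
  proof -
    have "(Y *v v i) \<bullet> (Y *v v j) = (A *v v i) \<bullet> v j"
      using inner_transpose_matrix[of Y "Y *v v i" "v j"]
      by (simp add: A_def flip: matrix_vector_mul_assoc)
    then show ?thesis by (simp add: eig v)
  qed
  have ZZ: "(Z *v v i) \<bullet> (Z *v v j) = (if i = j then 1 - l i else 0)" for i j
    using gram[of "v i" "v j"] by (auto simp: YY v split: if_splits)
  have v0: "v i \<noteq> 0" for i
    using v[of i i] by auto
  have l0: "0 < l i" for i
    using YY[of i i] inj(1)[of "v i"] v0[of i] by (metis inner_gt_zero_iff)
  have l1: "l i < 1" for i
    using ZZ[of i i] inj(2)[of "v i"] v0[of i] by (metis diff_gt_0_iff_gt inner_gt_zero_iff)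
  define b where "b = (\<chi> i. sqrt (l i))"
  define a where "a = (\<chi> i. sqrt (1 - l i))"
  define X where "X = (\<chi> r i. v i $ r)"
  define G where "G = (\<chi> r i. (Y *v v i) $ r / b $ i)"
  define W where "W = (\<chi> r i. (Z *v v i) $ r / a $ i)"
  have ab_pos: "0 < a $ i" "0 < b $ i" for i
    using l0[of i] l1[of i] by (simp_all add: a_def b_def)
  have col: "column i G = (Y *v v i) /\<^sub>R b $ i" "column i W = (Z *v v i) /\<^sub>R a $ i"
    "column i X = v i" for i
    by (simp_all add: column_def G_def W_def X_def vec_eq_iff divide_inverse mult.commute)
  have sq: "b $ i * b $ i = l i" "a $ i * a $ i = 1 - l i" for i
    using l0[of i] l1[of i] by (simp_all add: a_def b_def)
  have G: "column_orthonormal G"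
    using less_imp_neq[OF ab_pos(2)]
    by (auto simp: column_orthonormal_iff_inner col YY field_simps simp flip: sq(1))
  have W: "column_orthonormal W"
    using less_imp_neq[OF ab_pos(1)]
    by (auto simp: column_orthonormal_iff_inner col ZZ field_simps simp flip: sq(2))
  have X: "transpose X ** X = mat 1"
    using v column_orthonormal_iff_inner[of X] by (simp add: col column_orthonormal_def)
  then have X': "X ** transpose X = mat 1"
    by (simp add: matrix_left_right_inverse)
  then have "invertible X"
    using X by (auto simp: invertible_def)
  then have inv: "matrix_inv X = transpose X"
    using X' matrix_inv_left_right(2)[of X] by (metis matrix_mul_assoc matrix_mul_lid matrix_mul_rid)
  have MX: "(M ** X) $ r $ i = (M *v v i) $ r" for M :: "real^('p::{finite,linorder})^'k" and r i
    by (simp add: X_def matrix_matrix_mult_def matrix_vector_mult_def)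
  have "Y ** X = G ** diag_mat b"
    using ab_pos(2) by (simp add: vec_eq_iff MX matrix_diag_mat_nth G_def less_imp_neq[symmetric])
  then have Y_eq: "Y = G ** diag_mat b ** matrix_inv X"
    using X' inv by (metis matrix_mul_assoc matrix_mul_rid)
  have "Z ** X = W ** diag_mat a"
    using ab_pos(1) by (simp add: vec_eq_iff MX matrix_diag_mat_nth W_def less_imp_neq[symmetric])
  then have Z_eq: "Z = W ** diag_mat a ** matrix_inv X"
    using X' inv by (metis matrix_mul_assoc matrix_mul_rid)
  have "is_gsvd Y Z W G X a b"
    unfolding is_gsvd_def diag_mat_squares_sum_iff
    using Y_eq Z_eq W G \<open>invertible X\<close> ab_pos sq l0 l1 \<open>mono l\<close>
    by (auto simp: power2_eq_square a_def b_def monoD)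
  then show ?thesis by blast
qed

lemma is_gsvd_inner:
  assumes "is_gsvd Y Z W G X a b"
  shows "(Y *v (X *v x)) \<bullet> (Y *v (X *v y)) = (\<Sum>i\<in>UNIV. (b $ i)\<^sup>2 * (x $ i * y $ i))"
    and "(Z *v (X *v x)) \<bullet> (Z *v (X *v y)) = (\<Sum>i\<in>UNIV. (a $ i)\<^sup>2 * (x $ i * y $ i))"
proof -
  have inv: "matrix_inv X ** X = mat 1"
    using assms by (simp add: is_gsvd_def matrix_inv_left_right)
  have "Y = G ** diag_mat b ** matrix_inv X" "Z = W ** diag_mat a ** matrix_inv X"
    using assms by (simp_all add: is_gsvd_def)
  then have "Y ** X = G ** diag_mat b" "Z ** X = W ** diag_mat a"
    using inv by (metis matrix_mul_assoc matrix_mul_rid)+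
  then have "Y *v (X *v z) = G *v (diag_mat b *v z)" "Z *v (X *v z) = W *v (diag_mat a *v z)" for z
    by (simp_all add: matrix_vector_mul_assoc)
  moreover have "column_orthonormal G" "column_orthonormal W"
    using assms by (simp_all add: is_gsvd_def)
  ultimately show "(Y *v (X *v x)) \<bullet> (Y *v (X *v y)) = (\<Sum>i\<in>UNIV. (b $ i)\<^sup>2 * (x $ i * y $ i))"
    "(Z *v (X *v x)) \<bullet> (Z *v (X *v y)) = (\<Sum>i\<in>UNIV. (a $ i)\<^sup>2 * (x $ i * y $ i))"
    by (simp_all add: column_orthonormal_inner diag_mat_vector)
      (simp_all add: inner_vec_def power2_eq_square mult.assoc mult.left_commute)
qed

lemma is_gsvd_entries:
  assumes "is_gsvd Y Z W G X a b"
  shows "0 < a $ i" "0 < b $ i" "(a $ i)\<^sup>2 + (b $ i)\<^sup>2 = 1"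
  using assms by (auto simp: is_gsvd_def diag_mat_squares_sum_iff)

context
  fixes Y :: "real^('p::{finite,linorder})^'n" and Z :: "real^('p::{finite,linorder})^'m"
  assumes gram: "\<And>x y. (Y *v x) \<bullet> (Y *v y) + (Z *v x) \<bullet> (Z *v y) = x \<bullet> y"
begin

text \<open>Both Gram matrices are diagonal in the coordinates given by \<open>X\<close>, and they add up to the
  identity in either coordinate system because \<open>C\<^sup>2 + S\<^sup>2 = I\<close>.\<close>

lemma is_gsvd_orthogonal:
  assumes "is_gsvd Y Z W G X a b"
  shows "(X *v x) \<bullet> (X *v y) = x \<bullet> y"
proof -
  have "(X *v x) \<bullet> (X *v y) = (\<Sum>i\<in>UNIV. ((b $ i)\<^sup>2 + (a $ i)\<^sup>2) * (x $ i * y $ i))"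
    unfolding gram[symmetric] is_gsvd_inner[OF assms]
    by (simp add: distrib_right sum.distrib)
  then show ?thesis
    using is_gsvd_entries(3)[OF assms] by (simp add: inner_vec_def add.commute)
qed

text \<open>The squares of the \<open>b i\<close> are eigenvalues of the Gram matrix of \<open>Y\<close>, with the columns of \<open>X\<close> as
  eigenvectors. Expand the column \<open>i\<close> of a second \<open>X'\<close> in the columns of \<open>X\<close> and pair it with a
  column \<open>k\<close> that has a nonzero coefficient: the eigenvalues at \<open>i\<close> and \<open>k\<close> agree.\<close>

lemma gen_singular_values_eq:
  assumes svd: "is_gsvd Y Z W G X a b"
  shows "gen_singular_values Y Z = range (\<lambda>k. a $ k / b $ k)"
proof -
  have "a' $ i / b' $ i \<in> range (\<lambda>k. a $ k / b $ k)" if svd': "is_gsvd Y Z W' G' X' a' b'"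
    for W' G' X' a' b' i
  proof -
    have surj: "\<exists>u. M *v u = z" if "is_gsvd Y Z W G M a b" for W G M a b z
    proof -
      have "M ** matrix_inv M = mat 1"
        using that by (simp add: is_gsvd_def matrix_inv_left_right)
      then have "M *v (matrix_inv M *v z) = z"
        by (simp add: matrix_vector_mul_assoc)
      then show ?thesis ..
    qed
    define e where "e = axis i (1::real)"
    obtain u where u: "X *v u = X' *v e"
      using surj[OF svd] by blast
    have "u \<bullet> u = 1"
      using is_gsvd_orthogonal[OF svd, of u u] is_gsvd_orthogonal[OF svd', of e e]
      by (simp add: u) (simp add: e_def inner_axis_axis)
    then obtain k where k: "u $ k \<noteq> 0"
      by (metis inner_eq_zero_iff vec_eq_iff zero_index zero_neq_one)
    obtain w where w: "X' *v w = X *v axis k 1"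
      using surj[OF svd'] by blast
    have e_w: "(\<Sum>j\<in>UNIV. c j * (e $ j * w $ j)) = c i * (e \<bullet> w)" for c
      by (simp add: e_def axis_def inner_vec_def mult_delta_left mult_delta_right)
    have u_k: "(\<Sum>j\<in>UNIV. c j * (u $ j * axis k 1 $ j)) = c k * u $ k" for c
      by (simp add: axis_def mult_delta_right)
    have "(b $ k)\<^sup>2 * u $ k = (b' $ i)\<^sup>2 * (e \<bullet> w)"
      using is_gsvd_inner(1)[OF svd, of u "axis k 1"] is_gsvd_inner(1)[OF svd', of e w]
      unfolding u w e_w u_k by simp
    moreover have "e \<bullet> w = u $ k"
      using is_gsvd_orthogonal[OF svd, of u "axis k 1"] is_gsvd_orthogonal[OF svd', of e w]
      by (simp add: u w inner_axis)
    ultimately have "(b $ k)\<^sup>2 = (b' $ i)\<^sup>2"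
      using k by simp
    moreover from this have "(a $ k)\<^sup>2 = (a' $ i)\<^sup>2"
      using is_gsvd_entries(3)[OF svd, of k] is_gsvd_entries(3)[OF svd', of i] by simp
    ultimately have "b $ k = b' $ i" "a $ k = a' $ i"
      using is_gsvd_entries(1,2)[OF svd, of k] is_gsvd_entries(1,2)[OF svd', of i]
      by (auto intro: power2_eq_imp_eq less_imp_le)
    then have "a' $ i / b' $ i = a $ k / b $ k"
      by simp
    then show ?thesis
      by (rule range_eqI)
  qed
  then have "gen_singular_values Y Z \<subseteq> range (\<lambda>k. a $ k / b $ k)"
    unfolding gen_singular_values_def by fast
  moreover have "range (\<lambda>k. a $ k / b $ k) \<subseteq> gen_singular_values Y Z"
    unfolding gen_singular_values_def using svd by fast
  ultimately show ?thesis ..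
qed

text \<open>The constant is the reciprocal of the smallest singular value of \<open>Y\<close>. Because \<open>b\<close> increases, that
  value sits at the smallest index.\<close>

lemma norm_le_sigma_max:
  assumes inj: "\<And>x. Y *v x = 0 \<Longrightarrow> x = 0" "\<And>x. Z *v x = 0 \<Longrightarrow> x = 0"
  shows "norm x \<le> sqrt (1 + (sigma_max Y Z)\<^sup>2) * norm (Y *v x)"
proof -
  obtain W G X a b where svd: "is_gsvd Y Z W G X a b"
    using is_gsvd_exists[OF inj gram] by blast
  define k :: "'p::{finite,linorder}" where "k = Min UNIV"
  have b_min: "b $ k \<le> b $ i" for i
    using svd by (auto simp: is_gsvd_def k_def)
  have bk: "0 < b $ k" "0 < a $ k" "(a $ k)\<^sup>2 + (b $ k)\<^sup>2 = 1"
    using is_gsvd_entries[OF svd] by blast+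
  obtain u where u: "x = X *v u"
    using svd matrix_inv_left_right(1)[of X]
    by (metis is_gsvd_def matrix_vector_mul_assoc matrix_vector_mul_lid)
  have "(b $ k * norm x)\<^sup>2 = (\<Sum>i\<in>UNIV. (b $ k)\<^sup>2 * (u $ i * u $ i))"
    using is_gsvd_orthogonal[OF svd, of u u]
    by (simp add: u power_mult_distrib power2_norm_eq_inner sum_distrib_left inner_vec_def)
  also have "\<dots> \<le> (\<Sum>i\<in>UNIV. (b $ i)\<^sup>2 * (u $ i * u $ i))"
    using b_min bk(1) by (intro sum_mono mult_right_mono power_mono) auto
  also have "\<dots> = (norm (Y *v x))\<^sup>2"
    using is_gsvd_inner(1)[OF svd, of u u] by (simp add: u power2_norm_eq_inner)
  finally have "b $ k * norm x \<le> norm (Y *v x)"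
    by (rule power2_le_imp_le) simp
  then have "norm x \<le> 1 / b $ k * norm (Y *v x)"
    using bk(1) by (simp add: field_simps)
  also have "1 / b $ k \<le> sqrt (1 + (sigma_max Y Z)\<^sup>2)"
  proof -
    have "a $ k / b $ k \<le> sigma_max Y Z"
      unfolding sigma_max_def gen_singular_values_eq[OF svd] by (intro Max_ge) auto
    then have "(a $ k / b $ k)\<^sup>2 \<le> (sigma_max Y Z)\<^sup>2"
      using bk by (intro power_mono) auto
    moreover have "(1 / b $ k)\<^sup>2 = 1 + (a $ k / b $ k)\<^sup>2"
      using bk by (simp add: power_divide field_simps)
    ultimately show ?thesis
      by (intro real_le_rsqrt) simp
  qed
  finally show ?thesis
    by (simp add: mult_right_mono)
qed

end

section \<open>Perturbation of column spaces\<close>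

lemma column_space_eq_range: "column_space A = range (\<lambda>x. A *v x)"
proof
  show "column_space A \<subseteq> range (\<lambda>x. A *v x)"
    unfolding column_space_def
  proof (rule span_minimal)
    show "columns A \<subseteq> range (\<lambda>x. A *v x)"
      by (auto simp: columns_def simp flip: matrix_vector_mult_basis)
    show "subspace (range (\<lambda>x. A *v x))"
      by (intro linear_subspace_image) auto
  qed
  show "range (\<lambda>x. A *v x) \<subseteq> column_space A"
    unfolding column_space_def using matrix_vector_mult_in_columnspace by auto
qed

text \<open>The perturbation estimate without any singular values: \<open>Yt\<close> and \<open>Y\<close> may be any matrices that
  arise from \<open>Qt\<close> and \<open>Q\<close> by a common contraction, which is what \<open>compress\<close> expresses, and \<open>K\<close>
  is an inverse lower bound for \<open>Yt\<close>.\<close>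

lemma subspace_dist_column_space_le:
  fixes Qt Q :: "real^'p^'k" and Yt Y :: "real^'p^'n"
  assumes Qt: "column_orthonormal Qt" and rank: "rank Yt = rank Y" and "0 \<le> K"
    and lower: "\<And>x. norm x \<le> K * norm (Yt *v x)"
    and compress: "\<And>x y. norm (Yt *v x - Y *v y) \<le> norm (Qt *v x - Q *v y)"
  shows "subspace_dist (column_space Yt) (column_space Y)
    \<le> K * subspace_dist (column_space Qt) (column_space Q)"
proof (rule subspace_dist_le_one_sided_gap)
  let ?d = "subspace_dist (column_space Qt) (column_space Q)"
  have sub: "subspace (column_space A)" for A :: "real^'p^'k"
    by (simp add: column_space_def)
  show "dim (column_space Yt) = dim (column_space Y)"
    using rank by (simp add: column_space_eq_range rank_dim_range)
  show "0 \<le> K * ?d"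
    using \<open>0 \<le> K\<close> by (simp add: subspace_dist_nonneg)
  fix u assume "u \<in> column_space Yt"
  then obtain x where x: "u = Yt *v x"
    by (auto simp: column_space_eq_range)
  have "orth_projector (column_space Q) *v (Qt *v x) \<in> column_space Q"
    by (rule orth_projector_in[OF sub])
  then obtain y where y: "orth_projector (column_space Q) *v (Qt *v x) = Q *v y"
    by (auto simp: column_space_eq_range)
  have "norm (u - Y *v y) \<le> norm (Qt *v x - Q *v y)"
    unfolding x by (rule compress)
  also have "\<dots> \<le> ?d * norm (Qt *v x)"
  proof -
    have "Qt *v x \<in> column_space Qt"
      by (simp add: column_space_eq_range)
    from subspace_dist_residual_le[OF sub sub this, of Q] show ?thesis
      unfolding y .
  qed
  also have "\<dots> = ?d * norm x"
    using column_orthonormal_inner[OF Qt, of x x] by (simp add: norm_eq_sqrt_inner)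
  also have "\<dots> \<le> ?d * (K * norm u)"
    unfolding x by (intro mult_left_mono lower subspace_dist_nonneg)
  finally show "\<exists>t\<in>column_space Y. norm (u - t) \<le> K * ?d * norm u"
    by (intro bexI[of _ "Y *v y"]) (auto simp: column_space_eq_range mult.assoc mult.left_commute)
qed (simp_all add: column_space_def)

theorem lemma6p2:
  fixes Yt Y :: "real^('p::{finite,linorder})^'n"
    and Zt Z :: "real^('p::{finite,linorder})^'m"
  assumes "CARD('p) < CARD('n)" and "CARD('p) < CARD('m)"
    and "rank Yt = CARD('p)" and "rank Y = CARD('p)"
    and "rank Zt = CARD('p)" and "rank Z = CARD('p)"
    and "column_orthonormal (vstack Yt Zt)" and "column_orthonormal (vstack Y Z)"
  shows "subspace_dist (column_space Yt) (column_space Y)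
           \<le> sqrt (1 + (sigma_max Yt Zt)\<^sup>2)
              * subspace_dist (column_space (vstack Yt Zt)) (column_space (vstack Y Z))
    \<and> subspace_dist (column_space Zt) (column_space Z)
           \<le> sqrt (1 + (sigma_max Zt Yt)\<^sup>2)
              * subspace_dist (column_space (vstack Yt Zt)) (column_space (vstack Y Z))"
proof -
  have gram: "(Yt *v x) \<bullet> (Yt *v y) + (Zt *v x) \<bullet> (Zt *v y) = x \<bullet> y" for x y
    using column_orthonormal_inner[OF assms(7), of x y] by (simp add: vstack_inner)
  have inj_Y: "x = 0" if "Yt *v x = 0" for x
    using that \<open>rank Yt = CARD('p)\<close> matrix_nonfull_linear_equations_eq[of Yt] by blast
  have inj_Z: "x = 0" if "Zt *v x = 0" for x
    using that \<open>rank Zt = CARD('p)\<close> matrix_nonfull_linear_equations_eq[of Zt] by blast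
  have "norm x \<le> sqrt (1 + (sigma_max Yt Zt)\<^sup>2) * norm (Yt *v x)" for x
    using gram inj_Y inj_Z by (rule norm_le_sigma_max)
  moreover have "norm x \<le> sqrt (1 + (sigma_max Zt Yt)\<^sup>2) * norm (Zt *v x)" for x
    using gram[unfolded add.commute[of "(Yt *v _) \<bullet> _"]] inj_Z inj_Y by (rule norm_le_sigma_max)
  ultimately show ?thesis
    using assms by (intro conjI subspace_dist_column_space_le norm_blocks_le) auto
qed

end
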